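(* Let $G$ be a Lie group with Lie algebra $\mathfrak g$, let $\Delta t,\Delta s>0$, and let $N,A\ge 1$ be integers. Consider the discrete Lagrangian $\mathscr L_d(\triangle_a^j,g_a^j,\xi_a^j,\eta_a^j)=\Delta t\,\Delta s\,\big[K(\xi_a^j)-\Phi(\eta_a^j)-\Pi(g_a^j)\big]$ and a discrete field $g_d=\{g_a^j\}_{0\le j\le N,\,0\le a\le A}$ in $G$, with $\xi_a^j,\eta_a^j,\mu_a^j,\lambda_a^j$ associated to $g_d$ as in the context. The following are equivalent. (i) The discrete covariant Hamilton principle $$\delta\sum_{j=0}^{N-1}\sum_{a=0}^{A-1}\mathscr L_d(\triangle_a^j,g_a^j,\xi_a^j,\eta_a^j)=0$$ holds for arbitrary variations $\delta g_a^j\in T_{g_a^j}G$ vanishing at the spacetime boundary, i.e. $\delta g_a^j=0$ whenever $j\in\{0,N\}$ or $a\in\{0,A\}$. (ii) The discrete field $g_d$ satisfies the discrete covariant Euler-Lagrange equations $$\frac1{\Delta t}\Big(-\mu_a^j+\mathrm{Ad}^*_{\tau(\Delta t\,\xi_a^{j-1})}\mu_a^{j-1}\Big)+\frac1{\Delta s}\Big(\lambda_a^j-\mathrm{Ad}^*_{\tau(\Delta s\,\eta_{a-1}^j)}\lambda_{a-1}^j\Big)-(g_a^j)^{-1}D_{g_a^j}\Pi(g_a^j)=0$$ for all $j=1,\dots,N-1$ and $a=1,\dots,A-1$.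
   Context: $K,\Phi:\mathfrak g\to\mathbb R$ and $\Pi:G\to\mathbb R$ are smooth functions (kinetic, bending and potential energy densities). The map $\tau:\mathfrak g\to G$ is smooth, satisfies $\tau(0)=e$, and is a local diffeomorphism around the origin. The indices $j\in\{0,\dots,N\}$ and $a\in\{0,\dots,A\}$ are the time and space indices. $\triangle_a^j=((j,a),(j+1,a),(j,a+1))$, for $0\le j\le N-1$, $0\le a\le A-1$, denotes a triangle of the spacetime grid, and $X_d^\triangle$ is the set of all such triangles; $\mathscr L_d:X_d^\triangle\times G\times\mathfrak g\times\mathfrak g\to\mathbb R$. Given a discrete field $g_d=\{g_a^j\}$, the discrete convective velocities $\xi_a^j\in\mathfrak g$ and strains $\eta_a^j\in\mathfrak g$ are defined by $$\tau(\Delta t\,\xi_a^j)=(g_a^j)^{-1}g_a^{j+1},\qquad \tau(\Delta s\,\eta_a^j)=(g_a^j)^{-1}g_{a+1}^j .$$ It is understood that these group elements lie in the image of a neighborhood of $0$ on which $\tau$ is a diffeomorphism onto its image, and that $\xi_a^j,\eta_a^j$ are obtained from the inverse of $\tau$ there. The right trivialized derivative is $\mathrm d\tau_\xi:\mathfrak g\to\mathfrak g$, $\mathrm d\tau_\xi(\eta)=(T_\xi\tau(\eta))\,\tau(\xi)^{-1}$; $\mathrm d\tau_\xi^{-1}$ is its inverse as a linear map and $(\mathrm d\tau_\xi^{-1})^*:\mathfrak g^*\to\mathfrak g^*$ the dual map. The discrete momenta are $$\mu_a^j=\big(\mathrm d\tau^{-1}_{\Delta t\,\xi_a^j}\big)^*\partial_\xi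 K(\xi_a^j)\in\mathfrak g^*,\qquad \lambda_a^j=\big(\mathrm d\tau^{-1}_{\Delta s\,\eta_a^j}\big)^*\partial_\eta\Phi(\eta_a^j)\in\mathfrak g^*.$$ $\mathrm{Ad}^*_g:\mathfrak g^*\to\mathfrak g^*$ is the dual of $\mathrm{Ad}_g:\mathfrak g\to\mathfrak g$. $D_g\Pi(g)\in T_g^*G$ is the differential of $\Pi$ at $g$, and for $\alpha\in T_g^*G$ the element $g^{-1}\alpha\in\mathfrak g^*$ is defined by $\langle g^{-1}\alpha,\zeta\rangle=\langle\alpha,g\zeta\rangle$ for $\zeta\in\mathfrak g$, with $g\zeta$ the left translate of $\zeta$ to $T_gG$. In (i), $\delta$ denotes the first variation: the derivative at $\varepsilon=0$ along smooth curves $g_{a,\varepsilon}^j$ with $g_{a,0}^j=g_a^j$ and $\frac{d}{d\varepsilon}|_{\varepsilon=0}g_{a,\varepsilon}^j=\delta g_a^j$, where $\xi_a^j,\eta_a^j$ vary accordingly. *)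

theory Defs
  imports "HOL-Analysis.Analysis" "HOL-Algebra.Group"
begin

section \<open>Smooth maps between vector spaces\<close>

text \<open>
  Meant for open \<open>S\<close> and a finite-dimensional domain, where all directional derivatives being
  \<open>C\<^sup>n\<close> is the same as the derivative being \<open>C\<^sup>n\<close>.
\<close>

primrec Ck_on :: "nat \<Rightarrow> ('a::real_normed_vector \<Rightarrow> 'b::real_normed_vector) \<Rightarrow> 'a set \<Rightarrow> bool" where
  "Ck_on 0 f S \<longleftrightarrow> continuous_on S f"
| "Ck_on (Suc n) f S \<longleftrightarrow>
     (\<forall>x\<in>S. f differentiable (at x)) \<and> (\<forall>v. Ck_on n (\<lambda>x. frechet_derivative f (at x) v) S)"

definition smooth_on :: "'a set \<Rightarrow> ('a::real_normed_vector \<Rightarrow> 'b::real_normed_vector) \<Rightarrow> bool" where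
  "smooth_on S f \<longleftrightarrow> (\<forall>n. Ck_on n f S)"

section \<open>Smooth manifolds\<close>

text \<open>
  A manifold is a topological space (a type) together with an atlas of charts \<open>(U, \<phi>)\<close>; only the
  values of \<open>\<phi>\<close> on \<open>U\<close> matter. The model space is any finite-dimensional normed space rather than
  a member of \<open>euclidean_space\<close>, because the latter class excludes dimension 0.
\<close>

type_synonym ('g, 'e) atlas = "('g set \<times> ('g \<Rightarrow> 'e)) set"

abbreviation chart_inv :: "'g set \<times> ('g \<Rightarrow> 'e) \<Rightarrow> 'e \<Rightarrow> 'g" where
  "chart_inv c \<equiv> inv_into (fst c) (snd c)"

definition is_chart :: "('g::topological_space) set \<times> ('g \<Rightarrow> 'e::real_normed_vector) \<Rightarrow> bool" where
  "is_chart c \<longleftrightarrow> open (fst c) \<and> open (snd c ` fst c) \<and>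
     homeomorphism (fst c) (snd c ` fst c) (snd c) (chart_inv c)"

definition smooth_atlas :: "('g::topological_space, 'e::real_normed_vector) atlas \<Rightarrow> bool" where
  "smooth_atlas A \<longleftrightarrow> (\<forall>c\<in>A. is_chart c) \<and> (\<Union>c\<in>A. fst c) = UNIV \<and>
     (\<forall>c\<in>A. \<forall>d\<in>A. smooth_on (snd c ` (fst c \<inter> fst d)) (snd d \<circ> chart_inv c))"

definition vec_atlas :: "('a, 'a) atlas" where
  "vec_atlas = {(UNIV, id)}"

definition prod_atlas :: "('g, 'e) atlas \<Rightarrow> ('h, 'f) atlas \<Rightarrow> ('g \<times> 'h, 'e \<times> 'f) atlas" where
  "prod_atlas A B = {(U \<times> V, map_prod \<phi> \<psi>) | U \<phi> V \<psi>. (U, \<phi>) \<in> A \<and> (V, \<psi>) \<in> B}"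

text \<open>Smoothness on an open set \<open>S\<close> of a map between manifolds.\<close>

definition manifold_smooth_on ::
  "('g::topological_space, 'e::real_normed_vector) atlas \<Rightarrow>
   ('h::topological_space, 'f::real_normed_vector) atlas \<Rightarrow> 'g set \<Rightarrow> ('g \<Rightarrow> 'h) \<Rightarrow> bool" where
  "manifold_smooth_on A B S f \<longleftrightarrow> continuous_on S f \<and>
     (\<forall>c\<in>A. \<forall>d\<in>B. smooth_on (snd c ` (fst c \<inter> S \<inter> f -` fst d)) (snd d \<circ> f \<circ> chart_inv c))"

definition diffeomorphism_on ::
  "('g::topological_space, 'e::real_normed_vector) atlas \<Rightarrow>
   ('h::topological_space, 'f::real_normed_vector) atlas \<Rightarrow> 'g set \<Rightarrow> ('g \<Rightarrow> 'h) \<Rightarrow> bool" where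
  "diffeomorphism_on A B W f \<longleftrightarrow> open W \<and> open (f ` W) \<and> inj_on f W \<and>
     manifold_smooth_on A B W f \<and> manifold_smooth_on B A (f ` W) (inv_into W f)"

text \<open>
  Each point \<open>p\<close> gets a preferred chart, and the tangent space \<open>T\<^sub>p M\<close> is the model space, a vector
  of the model space standing for the tangent vector at \<open>p\<close> with these coordinates in the
  preferred chart at \<open>p\<close>. Every vector type thus carries a base point that is implicit in its use.
  For \<open>vec_atlas\<close> the only chart is the identity, so tangent vectors are ordinary vectors there
  and the tangent map of a map between vector spaces is its Frechet derivative.
\<close>

definition chart_at :: "('g, 'e) atlas \<Rightarrow> 'g \<Rightarrow> 'g set \<times> ('g \<Rightarrow> 'e)" where
  "chart_at A p = (SOME c. c \<in> A \<and> p \<in> fst c)"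

text \<open>The tangent map \<open>T\<^sub>p f\<close>, from the tangent space at \<open>p\<close> to the one at \<open>f p\<close>.\<close>

definition tangent_map ::
  "('g, 'e::real_normed_vector) atlas \<Rightarrow> ('h, 'f::real_normed_vector) atlas \<Rightarrow>
   ('g \<Rightarrow> 'h) \<Rightarrow> 'g \<Rightarrow> 'e \<Rightarrow> 'f" where
  "tangent_map A B f p =
     frechet_derivative (snd (chart_at B (f p)) \<circ> f \<circ> chart_inv (chart_at A p))
       (at (snd (chart_at A p) p))"

section \<open>Lie groups\<close>

locale lie_group = group G
  for G :: "('g::{t2_space, second_countable_topology}) monoid" (structure)
    and A :: "('g, 'e::real_normed_vector) atlas" +
  assumes carrier_UNIV: "carrier G = UNIV"
    and finite_dimensional: "\<exists>B::'e set. finite B \<and> span B = UNIV"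
    and smooth_atlas: "smooth_atlas A"
    and smooth_mult: "manifold_smooth_on (prod_atlas A A) A UNIV (\<lambda>(x, y). x \<otimes> y)"
    and smooth_inverse: "manifold_smooth_on A A UNIV (\<lambda>x. inv x)"

text \<open>
  The Lie algebra is the tangent space at the identity, that is, the model space \<open>'e\<close> (with
  respect to the chart \<open>chart_at A \<one>\<close>). Covectors are the linear functionals of type
  \<open>'e \<Rightarrow> real\<close>, and the dual of a linear map \<open>L\<close> is \<open>\<lambda>\<alpha>. \<alpha> \<circ> L\<close>.
\<close>

type_synonym 'e covector = "'e \<Rightarrow> real"

definition left_translate ::
  "'g monoid \<Rightarrow> ('g, 'e::real_normed_vector) atlas \<Rightarrow> 'g \<Rightarrow> 'e \<Rightarrow> 'e" where
  "left_translate G A g = tangent_map A A (\<lambda>h. g \<otimes>\<^bsub>G\<^esub> h) \<one>\<^bsub>G\<^esub>"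

definition left_trivialize ::
  "'g monoid \<Rightarrow> ('g, 'e::real_normed_vector) atlas \<Rightarrow> 'g \<Rightarrow> 'e covector \<Rightarrow> 'e covector" where
  "left_trivialize G A g \<alpha> = \<alpha> \<circ> left_translate G A g"

definition differential ::
  "('g, 'e::real_normed_vector) atlas \<Rightarrow> ('g \<Rightarrow> real) \<Rightarrow> 'g \<Rightarrow> 'e covector" where
  "differential A f g = tangent_map A vec_atlas f g"

definition Ad :: "'g monoid \<Rightarrow> ('g, 'e::real_normed_vector) atlas \<Rightarrow> 'g \<Rightarrow> 'e \<Rightarrow> 'e" where
  "Ad G A g = tangent_map A A (\<lambda>h. g \<otimes>\<^bsub>G\<^esub> h \<otimes>\<^bsub>G\<^esub> inv\<^bsub>G\<^esub> g) \<one>\<^bsub>G\<^esub>"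

definition Ad_star ::
  "'g monoid \<Rightarrow> ('g, 'e::real_normed_vector) atlas \<Rightarrow> 'g \<Rightarrow> 'e covector \<Rightarrow> 'e covector" where
  "Ad_star G A g \<mu> = \<mu> \<circ> Ad G A g"

text \<open>
  The right trivialized derivative: the tangent vector \<open>T\<^sub>\<xi> \<tau> \<eta>\<close> at \<open>\<tau> \<xi>\<close> is moved to the identity
  by right translation with the inverse of \<open>\<tau> \<xi>\<close>.
\<close>

definition dtau ::
  "'g monoid \<Rightarrow> ('g, 'e::real_normed_vector) atlas \<Rightarrow> ('e \<Rightarrow> 'g) \<Rightarrow> 'e \<Rightarrow> 'e \<Rightarrow> 'e" where
  "dtau G A \<tau> \<xi> \<eta> =
     tangent_map A A (\<lambda>h. h \<otimes>\<^bsub>G\<^esub> inv\<^bsub>G\<^esub> (\<tau> \<xi>)) (\<tau> \<xi>) (tangent_map vec_atlas A \<tau> \<xi> \<eta>)"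

definition dtau_inv ::
  "'g monoid \<Rightarrow> ('g, 'e::real_normed_vector) atlas \<Rightarrow> ('e \<Rightarrow> 'g) \<Rightarrow> 'e \<Rightarrow> 'e \<Rightarrow> 'e" where
  "dtau_inv G A \<tau> \<xi> = inv_into UNIV (dtau G A \<tau> \<xi>)"

section \<open>Discrete fields\<close>

text \<open>
  A discrete field is written \<open>g j a\<close>, with the time index \<open>j\<close> first. Throughout, \<open>W\<close> is a
  neighbourhood of 0 on which \<open>\<tau>\<close> is a diffeomorphism onto its image, and \<open>discrete_velocity\<close> is
  the solution \<open>\<zeta>\<close> of \<open>\<tau> (h \<zeta>) = x\<^sup>-\<^sup>1 y\<close> with \<open>h \<zeta> \<in> W\<close>; it is meaningful if
  \<open>x\<^sup>-\<^sup>1 y \<in> \<tau> ` W\<close>.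
\<close>

definition discrete_velocity ::
  "'g monoid \<Rightarrow> ('e::real_normed_vector \<Rightarrow> 'g) \<Rightarrow> 'e set \<Rightarrow> real \<Rightarrow> 'g \<Rightarrow> 'g \<Rightarrow> 'e" where
  "discrete_velocity G \<tau> W h x y = (1 / h) *\<^sub>R inv_into W \<tau> (inv\<^bsub>G\<^esub> x \<otimes>\<^bsub>G\<^esub> y)"

definition convective_velocity ::
  "'g monoid \<Rightarrow> ('e::real_normed_vector \<Rightarrow> 'g) \<Rightarrow> 'e set \<Rightarrow> real \<Rightarrow> (nat \<Rightarrow> nat \<Rightarrow> 'g) \<Rightarrow>
   nat \<Rightarrow> nat \<Rightarrow> 'e" where
  "convective_velocity G \<tau> W dt g j a = discrete_velocity G \<tau> W dt (g j a) (g (j + 1) a)"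

definition convective_strain ::
  "'g monoid \<Rightarrow> ('e::real_normed_vector \<Rightarrow> 'g) \<Rightarrow> 'e set \<Rightarrow> real \<Rightarrow> (nat \<Rightarrow> nat \<Rightarrow> 'g) \<Rightarrow>
   nat \<Rightarrow> nat \<Rightarrow> 'e" where
  "convective_strain G \<tau> W ds g j a = discrete_velocity G \<tau> W ds (g j a) (g j (a + 1))"

text \<open>
  The functional \<open>(d\<tau>\<^sup>-\<^sup>1 at h \<xi>)\<^sup>* (\<partial>F \<xi>)\<close>; it gives \<open>\<mu>\<close> for \<open>h = \<Delta>t\<close>, \<open>F = K\<close>
  and \<open>\<lambda>\<close> for \<open>h = \<Delta>s\<close>, \<open>F = \<Phi>\<close>.
\<close>

definition discrete_momentum ::
  "'g monoid \<Rightarrow> ('g, 'e::real_normed_vector) atlas \<Rightarrow> ('e \<Rightarrow> 'g) \<Rightarrow> real \<Rightarrow> ('e \<Rightarrow> real) \<Rightarrow> 'e \<Rightarrow>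
   'e covector" where
  "discrete_momentum G A \<tau> h F \<xi> = frechet_derivative F (at \<xi>) \<circ> dtau_inv G A \<tau> (h *\<^sub>R \<xi>)"

type_synonym triangle = "(nat \<times> nat) \<times> (nat \<times> nat) \<times> (nat \<times> nat)"

definition triangle :: "nat \<Rightarrow> nat \<Rightarrow> triangle" where
  "triangle j a = ((j, a), (j + 1, a), (j, a + 1))"

definition discrete_lagrangian ::
  "real \<Rightarrow> real \<Rightarrow> ('e \<Rightarrow> real) \<Rightarrow> ('e \<Rightarrow> real) \<Rightarrow> ('g \<Rightarrow> real) \<Rightarrow>
   triangle \<Rightarrow> 'g \<Rightarrow> 'e \<Rightarrow> 'e \<Rightarrow> real" where
  "discrete_lagrangian dt ds K \<Phi> Pot T g \<xi> \<eta> = dt * ds * (K \<xi> - \<Phi> \<eta> - Pot g)"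

definition discrete_action ::
  "'g monoid \<Rightarrow> ('e::real_normed_vector \<Rightarrow> 'g) \<Rightarrow> 'e set \<Rightarrow> real \<Rightarrow> real \<Rightarrow>
   (triangle \<Rightarrow> 'g \<Rightarrow> 'e \<Rightarrow> 'e \<Rightarrow> real) \<Rightarrow> nat \<Rightarrow> nat \<Rightarrow> (nat \<Rightarrow> nat \<Rightarrow> 'g) \<Rightarrow> real" where
  "discrete_action G \<tau> W dt ds L N M g =
     (\<Sum>j = 0..N - 1. \<Sum>a = 0..M - 1.
        L (triangle j a) (g j a) (convective_velocity G \<tau> W dt g j a) (convective_strain G \<tau> W ds g j a))"

text \<open>
  \<open>c\<close> is a smooth curve, defined for parameters near 0, that passes at 0 through \<open>p\<close> with
  velocity \<open>v\<close> (a tangent vector at \<open>p\<close>).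
\<close>

definition smooth_curve_through ::
  "('g::topological_space, 'e::real_normed_vector) atlas \<Rightarrow> (real \<Rightarrow> 'g) \<Rightarrow> 'g \<Rightarrow> 'e \<Rightarrow> bool" where
  "smooth_curve_through A c p v \<longleftrightarrow> (\<exists>r>0. manifold_smooth_on vec_atlas A {-r<..<r} c) \<and>
     c 0 = p \<and> tangent_map vec_atlas A c 0 1 = v"

end

theory Submission
  imports Defs
begin

text \<open>
  The action is a finite sum of energies of pairs of neighbouring group elements and of potential
  energies of single ones, so its first variation can be computed term by term. Write a
  variation in left trivialized form, \<open>\<delta>g = g \<zeta>\<close>. For neighbours \<open>x, y\<close> with relative position
  \<open>h = x\<^sup>-\<^sup>1 y\<close>, differentiating \<open>x h = y\<close> by the product rule gives
  \<open>\<delta>h = h \<zeta>\<^sub>y - \<zeta>\<^sub>x h\<close>, that is, \<open>\<delta>h h\<^sup>-\<^sup>1 = Ad\<^sub>h \<zeta>\<^sub>y - \<zeta>\<^sub>x\<close> (\<open>has_tangent_relative_position\<close>).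
  Since \<open>h = \<tau> (\<Delta> \<xi>)\<close>, the left hand side is also the right trivialized derivative of \<open>\<tau>\<close> at
  \<open>\<Delta> \<xi>\<close> applied to \<open>\<Delta> \<delta>\<xi>\<close>. Inverting it and pairing with the derivative of an energy
  \<open>F\<close> gives \<open>\<delta>F(\<xi>) = \<langle>Ad\<^sub>h\<^sup>* \<mu>, \<zeta>\<^sub>y\<rangle> / \<Delta> - \<langle>\<mu>, \<zeta>\<^sub>x\<rangle> / \<Delta>\<close>, where \<open>\<mu>\<close> is the discrete
  momentum (\<open>energy_variation\<close>). This is used for \<open>K\<close> with the time neighbours and for
  \<open>\<Phi>\<close> with the space neighbours.

  Because \<open>\<zeta>\<close> vanishes on the boundary, \<open>summation_by_parts\<close> moves the shifted \<open>\<zeta>\<close>s to the same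
  node. The first variation becomes \<open>\<Delta>t \<Delta>s\<close> times the sum over interior nodes of the left hand
  side of the Euler-Lagrange equation paired with the value of \<open>\<zeta>\<close> there. So the equations
  imply the principle; conversely, every \<open>\<zeta>\<close> concentrated at one interior node is
  realized by smooth curves (\<open>smooth_curve_through_exists\<close>), which extracts the equation there.

  The calculus on the group is phrased with a relation \<open>has_tangent\<close> saying that a map is
  differentiable at a point with a given tangent map; it comes with a chain rule and, on a Lie
  group, a product rule.
\<close>

section \<open>Smoothness along straight lines\<close>

lemma Ck_on_subset: "Ck_on n f S \<Longrightarrow> T \<subseteq> S \<Longrightarrow> Ck_on n f T"
  by (induction n arbitrary: f) (auto intro: continuous_on_subset)

lemma has_derivative_cong_nhds:
  assumes "(f has_derivative D) (at x)" and "eventually (\<lambda>y. f y = k y) (nhds x)"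
  shows "(k has_derivative D) (at x)"
  using assms(1)
  by (rule has_derivative_transform_eventually)
     (use assms(2) eventually_nhds_x_imp_x in \<open>auto simp: eventually_at_filter elim: eventually_mono\<close>)

lemma differentiable_cong_nhds:
  "f differentiable (at x) \<Longrightarrow> eventually (\<lambda>y. f y = k y) (nhds x) \<Longrightarrow> k differentiable (at x)"
  unfolding differentiable_def by (blast intro: has_derivative_cong_nhds)

lemma Ck_on_cong:
  assumes "open S" and "Ck_on n f S" and "\<And>x. x \<in> S \<Longrightarrow> f x = k x"
  shows "Ck_on n k S"
  using assms(2,3)
proof (induction n arbitrary: f k)
  case 0
  then show ?case using continuous_on_cong by auto
next
  case (Suc n)
  have ev: "eventually (\<lambda>y. f y = k y) (nhds x)" if "x \<in> S" for x
    using assms(1) Suc.prems(2) that eventually_nhds by blast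
  have "k differentiable (at x)" if "x \<in> S" for x
    using differentiable_cong_nhds[OF _ ev[OF that]] Suc.prems(1) that by auto
  moreover have "frechet_derivative f (at x) = frechet_derivative k (at x)" if "x \<in> S" for x
    using Suc.prems(1) that has_derivative_cong_nhds[OF _ ev[OF that]]
    by (auto intro!: frechet_derivative_at simp: frechet_derivative_works)
  ultimately show ?case
    using Suc.prems(1) Suc.IH[of "\<lambda>x. frechet_derivative f (at x) v" "\<lambda>x. frechet_derivative k (at x) v" for v]
    by auto
qed

text \<open>
  Each derivative along the line is again a function of this form, namely a directional derivative
  of \<open>f\<close> restricted to the line, which makes the induction on the order of smoothness go through.
\<close>

lemma Ck_on_line:
  fixes x v :: "'a::real_normed_vector"
  assumes "open S" and "Ck_on n f S"
  shows "Ck_on n (\<lambda>t::real. f (x + t *\<^sub>R v)) {t. x + t *\<^sub>R v \<in> S}"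
  using assms(2)
proof (induction n arbitrary: f)
  case 0
  then show ?case
    by (auto intro!: continuous_on_compose2[of S f] continuous_intros)
next
  case (Suc n)
  let ?T = "{t::real. x + t *\<^sub>R v \<in> S}"
  have T: "open ?T"
    using open_vimage[OF assms(1), of "\<lambda>t::real. x + t *\<^sub>R v"]
    by (simp add: vimage_def continuous_intros)
  have der: "((\<lambda>t::real. f (x + t *\<^sub>R v)) has_derivative
      (\<lambda>s. frechet_derivative f (at (x + t *\<^sub>R v)) (s *\<^sub>R v))) (at t)" if "t \<in> ?T" for t
  proof -
    have line: "((\<lambda>t::real. x + t *\<^sub>R v) has_derivative (\<lambda>s. s *\<^sub>R v)) (at t)"
      by (auto intro!: derivative_eq_intros)
    have "(f has_derivative frechet_derivative f (at (x + t *\<^sub>R v))) (at (x + t *\<^sub>R v))"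
      using Suc.prems that by (simp add: frechet_derivative_works)
    from has_derivative_compose[OF line this] show ?thesis by (simp add: o_def)
  qed
  have "Ck_on n (\<lambda>t. frechet_derivative (\<lambda>t::real. f (x + t *\<^sub>R v)) (at t) s) ?T" for s
  proof (rule Ck_on_cong[OF T])
    show "Ck_on n (\<lambda>t. frechet_derivative f (at (x + t *\<^sub>R v)) (s *\<^sub>R v)) ?T"
      using Suc.IH[of "\<lambda>y. frechet_derivative f (at y) (s *\<^sub>R v)"] Suc.prems by simp
    show "frechet_derivative f (at (x + t *\<^sub>R v)) (s *\<^sub>R v) =
        frechet_derivative (\<lambda>t::real. f (x + t *\<^sub>R v)) (at t) s" if "t \<in> ?T" for t
      using frechet_derivative_at[OF der[OF that]] by (rule fun_cong)
  qed
  moreover have "(\<lambda>t::real. f (x + t *\<^sub>R v)) differentiable (at t)" if "t \<in> ?T" for t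
    using der[OF that] differentiable_def by blast
  ultimately show ?case by simp
qed

section \<open>Derivatives in the preferred charts\<close>

text \<open>
  The part of \<open>smooth_atlas\<close> that the first order calculus rests on: every point lies in the
  domain of its preferred chart, and charts are homeomorphisms.
\<close>

definition chart_cover :: "('g::topological_space, 'e::real_normed_vector) atlas \<Rightarrow> bool" where
  "chart_cover A \<longleftrightarrow> (\<forall>c\<in>A. is_chart c) \<and> (\<Union>c\<in>A. fst c) = UNIV"

lemma chart_cover_vec_atlas: "chart_cover vec_atlas"
  by (auto simp: chart_cover_def vec_atlas_def is_chart_def homeomorphism_def)

lemma chart_at_vec_atlas [simp]: "chart_at vec_atlas p = (UNIV, id)"
  by (auto simp: chart_at_def vec_atlas_def intro!: some_equality)

lemma chart_cover_chart_at:
  assumes "chart_cover A"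
  shows "chart_at A p \<in> A" and "is_chart (chart_at A p)" and "p \<in> fst (chart_at A p)"
proof -
  have "p \<in> (\<Union>c\<in>A. fst c)"
    using assms by (simp add: chart_cover_def)
  then have "\<exists>c. c \<in> A \<and> p \<in> fst c" by blast
  from someI_ex[OF this] show *: "chart_at A p \<in> A" and "p \<in> fst (chart_at A p)"
    by (auto simp: chart_at_def)
  show "is_chart (chart_at A p)" using * assms by (auto simp: chart_cover_def)
qed

lemma is_chart_inv:
  assumes "is_chart c"
  shows "q \<in> fst c \<Longrightarrow> chart_inv c (snd c q) = q" and "x \<in> snd c ` fst c \<Longrightarrow> snd c (chart_inv c x) = x"
    and "x \<in> snd c ` fst c \<Longrightarrow> chart_inv c x \<in> fst c"
  using assms by (auto simp: is_chart_def homeomorphism_def inv_into_into)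

lemma is_chart_eventually:
  assumes "is_chart c" and "p \<in> fst c"
  shows "eventually (\<lambda>q. q \<in> fst c) (nhds p)"
    and "eventually (\<lambda>x. x \<in> snd c ` fst c) (nhds (snd c p))"
  using assms by (auto simp: is_chart_def intro!: eventually_nhds_in_open)

lemma continuous_on_open_tendsto_nhds:
  assumes "continuous_on S f" and "open S" and "p \<in> S"
  shows "(f \<longlongrightarrow> f p) (nhds p)"
  using assms by (metis continuous_on_def at_within_open tendsto_at_iff_tendsto_nhds)

lemma is_chart_tendsto:
  assumes "is_chart c" and "p \<in> fst c"
  shows "(snd c \<longlongrightarrow> snd c p) (nhds p)" and "(chart_inv c \<longlongrightarrow> p) (nhds (snd c p))"
proof -
  show "(snd c \<longlongrightarrow> snd c p) (nhds p)"
    using assms by (intro continuous_on_open_tendsto_nhds[of "fst c"])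
      (auto simp: is_chart_def homeomorphism_def)
  show "(chart_inv c \<longlongrightarrow> p) (nhds (snd c p))"
    using assms continuous_on_open_tendsto_nhds[of "snd c ` fst c" "chart_inv c" "snd c p"]
      is_chart_inv(1)[OF assms]
    by (auto simp: is_chart_def homeomorphism_def)
qed

text \<open>
  \<open>tangent_map\<close> has a value even where the coordinate expression is not differentiable;
  \<open>has_tangent\<close> adds that it is. Continuity is part of the notion: the coordinate expression is
  meaningful only where \<open>f\<close> takes values in the domain of the chart at \<open>f p\<close>, and without
  continuity differentiability of the expression would say nothing about \<open>f\<close> there.
\<close>

definition has_tangent ::
  "('g::topological_space, 'e::real_normed_vector) atlas \<Rightarrow>
   ('h::topological_space, 'f::real_normed_vector) atlas \<Rightarrow> ('g \<Rightarrow> 'h) \<Rightarrow> 'g \<Rightarrow> ('e \<Rightarrow> 'f) \<Rightarrow> bool" where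
  "has_tangent A B f p D \<longleftrightarrow> (f \<longlongrightarrow> f p) (nhds p) \<and>
     ((snd (chart_at B (f p)) \<circ> f \<circ> chart_inv (chart_at A p)) has_derivative D)
       (at (snd (chart_at A p) p))"

lemma has_tangent_tangent_map: "has_tangent A B f p D \<Longrightarrow> tangent_map A B f p = D"
  unfolding has_tangent_def tangent_map_def by (auto dest: frechet_derivative_at)

lemma has_tangent_linear: "has_tangent A B f p D \<Longrightarrow> linear D"
  unfolding has_tangent_def by (auto intro: has_derivative_linear)

lemma has_tangent_unique: "has_tangent A B f p D \<Longrightarrow> has_tangent A B f p D' \<Longrightarrow> D = D'"
  by (metis has_tangent_tangent_map)

lemma smooth_on_differentiable: "smooth_on S f \<Longrightarrow> x \<in> S \<Longrightarrow> f differentiable (at x)"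
  unfolding smooth_on_def by (metis Ck_on.simps(2))

lemma manifold_smooth_on_has_tangent:
  assumes "chart_cover A" and "chart_cover B" and "manifold_smooth_on A B S f" and "open S" and "p \<in> S"
  shows "has_tangent A B f p (tangent_map A B f p)"
proof -
  let ?c = "chart_at A p" and ?d = "chart_at B (f p)"
  have "snd ?c p \<in> snd ?c ` (fst ?c \<inter> S \<inter> f -` fst ?d)"
    using assms chart_cover_chart_at(3)[OF assms(1)] chart_cover_chart_at(3)[OF assms(2)] by blast
  moreover have "smooth_on (snd ?c ` (fst ?c \<inter> S \<inter> f -` fst ?d)) (snd ?d \<circ> f \<circ> chart_inv ?c)"
    using assms(3) chart_cover_chart_at(1)[OF assms(1)] chart_cover_chart_at(1)[OF assms(2)]
    by (auto simp: manifold_smooth_on_def)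
  ultimately have "(snd ?d \<circ> f \<circ> chart_inv ?c) differentiable (at (snd ?c p))"
    by (rule smooth_on_differentiable[rotated])
  moreover have "(f \<longlongrightarrow> f p) (nhds p)"
    using assms by (auto simp: manifold_smooth_on_def intro: continuous_on_open_tendsto_nhds)
  ultimately show ?thesis
    by (simp add: has_tangent_def tangent_map_def frechet_derivative_works)
qed

lemma has_tangent_cong:
  assumes "chart_cover A" and "has_tangent A B f p D" and "eventually (\<lambda>q. f q = k q) (nhds p)"
  shows "has_tangent A B k p D"
proof -
  have fp: "f p = k p" using assms(3) by (rule eventually_nhds_x_imp_x)
  have "eventually (\<lambda>x. f (chart_inv (chart_at A p) x) = k (chart_inv (chart_at A p) x))
      (nhds (snd (chart_at A p) p))"
    using assms(3) is_chart_tendsto(2)[OF chart_cover_chart_at(2,3)[OF assms(1)]]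
    by (rule eventually_compose_filterlim)
  then show ?thesis
    using assms(2) tendsto_cong[OF assms(3)] fp
    by (auto simp: has_tangent_def elim!: has_derivative_cong_nhds eventually_mono)
qed

text \<open>
  Near \<open>p\<close> the chart at \<open>f p\<close> cancels between the two coordinate expressions, since continuity
  keeps \<open>f\<close> in its domain; what is left is the chain rule in the model spaces.
\<close>

lemma has_tangent_compose:
  assumes "chart_cover A" and "chart_cover B"
    and f: "has_tangent A B f p D" and k: "has_tangent B C k (f p) E"
  shows "has_tangent A C (\<lambda>q. k (f q)) p (\<lambda>v. E (D v))"
proof -
  let ?a = "chart_at A p" and ?b = "chart_at B (f p)" and ?c = "chart_at C (k (f p))"
  note a = chart_cover_chart_at(2,3)[OF assms(1), of p] and b = chart_cover_chart_at(2,3)[OF assms(2), of "f p"]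
  have pa: "chart_inv ?a (snd ?a p) = p" by (rule is_chart_inv(1)[OF a])
  have "((snd ?c \<circ> k \<circ> chart_inv ?b) \<circ> (snd ?b \<circ> f \<circ> chart_inv ?a) has_derivative E \<circ> D) (at (snd ?a p))"
    using f k pa by (intro diff_chain_at) (auto simp: has_tangent_def)
  moreover have "eventually (\<lambda>x. f (chart_inv ?a x) \<in> fst ?b) (nhds (snd ?a p))"
    using is_chart_eventually(1)[OF b] f
      eventually_compose_filterlim[OF _ is_chart_tendsto(2)[OF a]]
    by (fastforce simp: has_tangent_def dest: eventually_compose_filterlim)
  then have "eventually (\<lambda>x. ((snd ?c \<circ> k \<circ> chart_inv ?b) \<circ> (snd ?b \<circ> f \<circ> chart_inv ?a)) x =
      (snd ?c \<circ> (\<lambda>q. k (f q)) \<circ> chart_inv ?a) x) (nhds (snd ?a p))"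
    by eventually_elim (simp add: is_chart_inv(1)[OF b(1)])
  ultimately have "((snd ?c \<circ> (\<lambda>q. k (f q)) \<circ> chart_inv ?a) has_derivative E \<circ> D) (at (snd ?a p))"
    by (rule has_derivative_cong_nhds)
  moreover have "((\<lambda>q. k (f q)) \<longlongrightarrow> k (f p)) (nhds p)"
    using f k by (auto simp: has_tangent_def intro: filterlim_compose)
  ultimately show ?thesis by (simp add: has_tangent_def o_def)
qed

lemma has_tangent_ident:
  assumes "chart_cover A"
  shows "has_tangent A A (\<lambda>q. q) p (\<lambda>v. v)"
proof -
  note a = chart_cover_chart_at(2,3)[OF assms(1), of p]
  have "eventually (\<lambda>x. x = (snd (chart_at A p) \<circ> (\<lambda>q. q) \<circ> chart_inv (chart_at A p)) x)
      (nhds (snd (chart_at A p) p))"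
    using is_chart_eventually(2)[OF a] by eventually_elim (simp add: is_chart_inv(2)[OF a(1)])
  then show ?thesis
    unfolding has_tangent_def
    by (auto intro!: has_derivative_cong_nhds[OF has_derivative_ident] simp: filterlim_ident)
qed

lemma has_tangent_const: "has_tangent A B (\<lambda>q. b) p (\<lambda>v. 0)"
  by (auto simp: has_tangent_def o_def)

lemma has_tangent_vec_atlas:
  "has_tangent vec_atlas vec_atlas f x D \<longleftrightarrow> (f has_derivative D) (at x)"
proof -
  have "(f \<longlongrightarrow> f x) (nhds x)" if "(f has_derivative D) (at x)"
    using has_derivative_continuous[OF that] by (simp add: isCont_def tendsto_at_iff_tendsto_nhds)
  then show ?thesis by (auto simp: has_tangent_def)
qed

lemma smooth_curve_through_has_tangent:
  assumes "chart_cover A" and "smooth_curve_through A c p v"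
  shows "c 0 = p" and "has_tangent vec_atlas A c 0 (\<lambda>s. s *\<^sub>R v)"
proof -
  obtain r where r: "r > 0" "manifold_smooth_on vec_atlas A {-r<..<r} c"
    and c: "c 0 = p" "tangent_map vec_atlas A c 0 1 = v"
    using assms(2) by (auto simp: smooth_curve_through_def)
  show "c 0 = p" by fact
  have *: "has_tangent vec_atlas A c 0 (tangent_map vec_atlas A c 0)"
    using r by (intro manifold_smooth_on_has_tangent[OF chart_cover_vec_atlas assms(1)]) auto
  have "tangent_map vec_atlas A c 0 s = s *\<^sub>R v" for s
    using linear_scale[OF has_tangent_linear[OF *], of s 1] c by simp
  with * show "has_tangent vec_atlas A c 0 (\<lambda>s. s *\<^sub>R v)"
    by (metis (no_types, lifting) ext)
qed

text \<open>
  The inverse image of a straight line in the preferred chart has the prescribed velocity by the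
  very definition of tangent vectors. Its expression in any other chart is a chart transition along
  a line, so it is smooth by \<open>Ck_on_line\<close>.
\<close>

lemma smooth_curve_through_exists:
  assumes "smooth_atlas A"
  shows "\<exists>c. smooth_curve_through A c p v"
proof -
  have cover: "chart_cover A" using assms by (auto simp: smooth_atlas_def chart_cover_def)
  let ?a = "chart_at A p"
  note a = chart_cover_chart_at(2,3)[OF cover, of p]
  let ?l = "\<lambda>t::real. snd ?a p + t *\<^sub>R v"
  define c where "c = (\<lambda>t. chart_inv ?a (?l t))"
  have "open (?l -` (snd ?a ` fst ?a))"
    using a(1) by (intro open_vimage) (auto simp: is_chart_def intro!: continuous_intros)
  moreover have "0 \<in> ?l -` (snd ?a ` fst ?a)" using a(2) by simp
  ultimately obtain r where r: "r > 0" "ball 0 r \<subseteq> ?l -` (snd ?a ` fst ?a)"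
    by (meson open_contains_ball)
  have ball: "ball 0 r = {-r<..<r}" by (auto simp: dist_real_def)
  have l: "?l t \<in> snd ?a ` fst ?a" if "t \<in> {-r<..<r}" for t
    using r(2) that unfolding ball by blast
  have c0: "c 0 = p" using is_chart_inv(1)[OF a] by (simp add: c_def)
  have "smooth_on (id ` (UNIV \<inter> {-r<..<r} \<inter> c -` fst d)) (snd d \<circ> c \<circ> inv_into UNIV id)" if d: "d \<in> A" for d
  proof -
    let ?S = "snd ?a ` (fst ?a \<inter> fst d)"
    have "openin (top_of_set (snd ?a ` fst ?a)) ?S"
      using a(1) d assms
      by (intro homeomorphism_imp_open_map[of "fst ?a" _ "snd ?a" "chart_inv ?a"])
         (auto simp: is_chart_def smooth_atlas_def intro!: openin_open_Int)
    then have S: "open ?S"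
      using a(1) by (auto simp: is_chart_def dest: openin_open_trans)
    have "smooth_on ?S (snd d \<circ> chart_inv ?a)"
      using assms d chart_cover_chart_at(1)[OF cover] by (auto simp: smooth_atlas_def)
    then have "smooth_on {t. ?l t \<in> ?S} (\<lambda>t. (snd d \<circ> chart_inv ?a) (?l t))"
      unfolding smooth_on_def using Ck_on_line[OF S] by blast
    moreover have "{-r<..<r} \<inter> c -` fst d \<subseteq> {t. ?l t \<in> ?S}"
    proof
      fix t assume t: "t \<in> {-r<..<r} \<inter> c -` fst d"
      then have "c t \<in> fst ?a \<inter> fst d" and "snd ?a (c t) = ?l t"
        using l[of t] is_chart_inv(2,3)[OF a(1)] by (auto simp: c_def)
      then show "t \<in> {t. ?l t \<in> ?S}" by (metis image_eqI mem_Collect_eq)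
    qed
    ultimately show ?thesis
      unfolding smooth_on_def by (auto simp: c_def o_def intro: Ck_on_subset)
  qed
  moreover have "continuous_on {-r<..<r} c"
    unfolding c_def
  proof (rule continuous_on_compose2[of "snd ?a ` fst ?a" "chart_inv ?a" "{-r<..<r}" ?l])
    show "continuous_on (snd ?a ` fst ?a) (chart_inv ?a)"
      using a(1) by (simp add: is_chart_def homeomorphism_def)
    show "continuous_on {-r<..<r} ?l" by (intro continuous_intros)
    show "?l ` {-r<..<r} \<subseteq> snd ?a ` fst ?a" using l by blast
  qed
  ultimately have "manifold_smooth_on vec_atlas A {-r<..<r} c"
    by (simp add: manifold_smooth_on_def vec_atlas_def)
  moreover have "tangent_map vec_atlas A c 0 1 = v"
  proof -
    have "eventually (\<lambda>t. t \<in> {-r<..<r}) (nhds (0::real))"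
      using r(1) by (intro eventually_nhds_in_open) auto
    then have "eventually (\<lambda>t. ?l t = (snd ?a \<circ> c \<circ> id) t) (nhds 0)"
      by eventually_elim (simp add: c_def is_chart_inv(2)[OF a(1) l])
    moreover have "(?l has_derivative (\<lambda>s. s *\<^sub>R v)) (at 0)"
      by (auto intro!: derivative_eq_intros)
    ultimately have "((snd ?a \<circ> c \<circ> id) has_derivative (\<lambda>s. s *\<^sub>R v)) (at 0)"
      by (rule has_derivative_cong_nhds[rotated])
    then show ?thesis
      by (simp add: tangent_map_def c0 frechet_derivative_at[symmetric])
  qed
  ultimately show ?thesis
    unfolding smooth_curve_through_def using r(1) c0 by blast
qed

section \<open>Translations in a Lie group\<close>

context lie_group
begin

lemma cover: "chart_cover A"
  using smooth_atlas by (auto simp: smooth_atlas_def chart_cover_def)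

lemma in_carrier [simp]: "x \<in> carrier G"
  by (simp add: carrier_UNIV)

abbreviation push_left :: "'g \<Rightarrow> 'g \<Rightarrow> 'e \<Rightarrow> 'e" where
  "push_left x y \<equiv> tangent_map A A (\<lambda>h. x \<otimes> h) y"

abbreviation push_right :: "'g \<Rightarrow> 'g \<Rightarrow> 'e \<Rightarrow> 'e" where
  "push_right x y \<equiv> tangent_map A A (\<lambda>h. h \<otimes> x) y"

text \<open>
  The preferred chart of the product atlas at \<open>(x, y)\<close> need not be the product of the preferred
  charts at \<open>x\<close> and \<open>y\<close>. The derivative is therefore taken in that product of charts,
  where partial derivatives are the tangent maps of translations.
\<close>

lemma mult_has_derivative:
  fixes x y :: 'g
  defines "a \<equiv> chart_at A x" and "b \<equiv> chart_at A y" and "c \<equiv> chart_at A (x \<otimes> y)"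
  obtains D where "((\<lambda>(u, v). snd c (chart_inv a u \<otimes> chart_inv b v)) has_derivative D) (at (snd a x, snd b y))"
proof -
  note a = chart_cover_chart_at[OF cover, of x, folded a_def]
    and b = chart_cover_chart_at[OF cover, of y, folded b_def]
    and c = chart_cover_chart_at[OF cover, of "x \<otimes> y", folded c_def]
  let ?m = "\<lambda>(x, y). x \<otimes> y"
  let ?ab = "(fst a \<times> fst b, map_prod (snd a) (snd b))"
  have "?ab \<in> prod_atlas A A"
    unfolding prod_atlas_def by (rule CollectI, intro exI conjI, rule refl) (use a(1) b(1) in simp_all)
  then have "smooth_on (snd ?ab ` (fst ?ab \<inter> UNIV \<inter> ?m -` fst c)) (snd c \<circ> ?m \<circ> chart_inv ?ab)"
    using smooth_mult c(1) unfolding manifold_smooth_on_def by blast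
  moreover have "(snd a x, snd b y) \<in> snd ?ab ` (fst ?ab \<inter> UNIV \<inter> ?m -` fst c)"
    using a(3) b(3) c(3) by (auto intro!: image_eqI[of _ _ "(x, y)"])
  ultimately obtain D where
    D: "(snd c \<circ> ?m \<circ> chart_inv ?ab has_derivative D) (at (snd a x, snd b y))"
    using smooth_on_differentiable differentiable_def by blast
  have inj: "inj_on (map_prod (snd a) (snd b)) (fst a \<times> fst b)"
    using is_chart_inv(1)[OF a(2)] is_chart_inv(1)[OF b(2)]
    by (auto simp: inj_on_def) (metis, metis)
  have "chart_inv ?ab (u, v) = (chart_inv a u, chart_inv b v)"
    if "u \<in> snd a ` fst a" and "v \<in> snd b ` fst b" for u v
    using that inv_into_f_eq[OF inj, of "(chart_inv a u, chart_inv b v)" "(u, v)"]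
      is_chart_inv(2,3)[OF a(2)] is_chart_inv(2,3)[OF b(2)] by simp
  moreover have "eventually (\<lambda>z. z \<in> (snd a ` fst a) \<times> (snd b ` fst b)) (nhds (snd a x, snd b y))"
    using a b by (intro eventually_nhds_in_open open_Times) (auto simp: is_chart_def)
  ultimately have "eventually (\<lambda>z. (snd c \<circ> ?m \<circ> chart_inv ?ab) z =
      (\<lambda>(u, v). snd c (chart_inv a u \<otimes> chart_inv b v)) z) (nhds (snd a x, snd b y))"
    by (auto elim!: eventually_mono)
  from that[OF has_derivative_cong_nhds[OF D this]] show thesis .
qed

text \<open>
  The product rule. With \<open>M\<close> the derivative of the multiplication in coordinates, the tangent map is
  \<open>M (D v, E v) = M (D v, 0) + M (0, E v)\<close>, and the two summands are identified by applying the same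
  computation to products with one constant factor.
\<close>

lemma has_tangent_mult:
  assumes "chart_cover C" and f: "has_tangent C A f p D" and k: "has_tangent C A k p E"
  shows "has_tangent C A (\<lambda>q. f q \<otimes> k q) p (\<lambda>v. push_right (k p) (f p) (D v) + push_left (f p) (k p) (E v))"
proof -
  let ?c = "chart_at A (f p \<otimes> k p)"
  obtain M where M: "((\<lambda>(u, v). snd ?c (chart_inv (chart_at A (f p)) u \<otimes> chart_inv (chart_at A (k p)) v))
      has_derivative M) (at (snd (chart_at A (f p)) (f p), snd (chart_at A (k p)) (k p)))"
    by (rule mult_has_derivative)
  have product: "has_tangent C' A (\<lambda>q. f' q \<otimes> k' q) p' (\<lambda>v. M (D' v, E' v))"
    \<comment> \<open>The domain is arbitrary here: besides that of the given maps, the group itself is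
      needed, with a constant map and the identity as the factors.\<close>
    if "chart_cover C'" and f': "has_tangent C' A f' p' D'" and k': "has_tangent C' A k' p' E'"
      and fp: "f' p' = f p" and kp: "k' p' = k p"
    for C' :: "('h::topological_space, 'f::real_normed_vector) atlas" and f' k' p' D' E'
  proof -
    let ?a = "chart_at A (f p)" and ?b = "chart_at A (k p)" and ?d = "chart_at C' p'"
    note a = chart_cover_chart_at(2,3)[OF cover, of "f p"]
      and b = chart_cover_chart_at(2,3)[OF cover, of "k p"]
      and d = chart_cover_chart_at(2,3)[OF that(1), of p']
    have inv: "chart_inv ?d (snd ?d p') = p'" by (rule is_chart_inv(1)[OF d])
    let ?m = "\<lambda>(u, v). snd ?c (chart_inv ?a u \<otimes> chart_inv ?b v)"
    let ?fk = "\<lambda>x. ((snd ?a \<circ> f' \<circ> chart_inv ?d) x, (snd ?b \<circ> k' \<circ> chart_inv ?d) x)"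
    have "(?fk has_derivative (\<lambda>v. (D' v, E' v))) (at (snd ?d p'))"
      using f' k' fp kp by (intro has_derivative_Pair) (auto simp: has_tangent_def simp del: o_apply)
    moreover have "(?m has_derivative M) (at (?fk (snd ?d p')))"
      using M by (simp add: inv fp kp)
    ultimately have 1: "((\<lambda>x. ?m (?fk x)) has_derivative (\<lambda>v. M (D' v, E' v))) (at (snd ?d p'))"
      by (rule has_derivative_compose)
    have limf: "(f' \<longlongrightarrow> f p) (nhds p')" and limk: "(k' \<longlongrightarrow> k p) (nhds p')"
      using f' k' fp kp by (auto simp: has_tangent_def)
    have "eventually (\<lambda>q. f' q \<in> fst ?a \<and> k' q \<in> fst ?b) (nhds p')"
      using eventually_compose_filterlim[OF is_chart_eventually(1)[OF a] limf]
        eventually_compose_filterlim[OF is_chart_eventually(1)[OF b] limk]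
      by eventually_elim blast
    then have "eventually (\<lambda>x. f' (chart_inv ?d x) \<in> fst ?a \<and> k' (chart_inv ?d x) \<in> fst ?b) (nhds (snd ?d p'))"
      by (rule eventually_compose_filterlim[OF _ is_chart_tendsto(2)[OF d]])
    then have "eventually (\<lambda>x. ?m (?fk x) =
        (snd ?c \<circ> (\<lambda>q. f' q \<otimes> k' q) \<circ> chart_inv ?d) x) (nhds (snd ?d p'))"
      by eventually_elim (simp add: is_chart_inv(1)[OF a(1)] is_chart_inv(1)[OF b(1)])
    note 2 = has_derivative_cong_nhds[OF 1 this]
    have "((\<lambda>(x, y). x \<otimes> y) \<longlongrightarrow> (\<lambda>(x, y). x \<otimes> y) (f p, k p)) (nhds (f p, k p))"
      using smooth_mult by (intro continuous_on_open_tendsto_nhds[of UNIV]) (auto simp: manifold_smooth_on_def)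
    from filterlim_compose[OF this] tendsto_Pair[OF limf limk]
    have "((\<lambda>q. f' q \<otimes> k' q) \<longlongrightarrow> f p \<otimes> k p) (nhds p')" by fastforce
    then show ?thesis using 2 by (simp add: has_tangent_def fp kp del: o_apply)
  qed
  have left: "push_left (f p) (k p) = (\<lambda>v. M (0, v))"
    by (rule has_tangent_tangent_map,
        rule product[OF cover has_tangent_const[of A A "f p" "k p"] has_tangent_ident[OF cover, of "k p"]]) simp_all
  have right: "push_right (k p) (f p) = (\<lambda>v. M (v, 0))"
    by (rule has_tangent_tangent_map,
        rule product[OF cover has_tangent_ident[OF cover, of "f p"] has_tangent_const[of A A "k p" "f p"]]) simp_all
  have split: "M (u, v) = M (u, 0) + M (0, v)" for u v
    using linear_add[OF has_derivative_linear[OF M], of "(u, 0)" "(0, v)"] by simp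
  show ?thesis
    using product[OF assms refl refl] by (simp add: left right flip: split)
qed

lemma has_tangent_left_mult: "has_tangent A A (\<lambda>h. x \<otimes> h) y (push_left x y)"
  using has_tangent_mult[OF cover has_tangent_const has_tangent_ident[OF cover]]
  by (metis has_tangent_tangent_map)

lemma has_tangent_right_mult: "has_tangent A A (\<lambda>h. h \<otimes> x) y (push_right x y)"
  using has_tangent_mult[OF cover has_tangent_ident[OF cover] has_tangent_const]
  by (metis has_tangent_tangent_map)

lemma push_left_push_left: "push_left x (y \<otimes> z) (push_left y z v) = push_left (x \<otimes> y) z v"
  using has_tangent_tangent_map[OF has_tangent_compose[OF cover cover has_tangent_left_mult[of y z] has_tangent_left_mult[of x]]]
  by (simp add: m_assoc)

lemma push_right_push_right: "push_right x (z \<otimes> y) (push_right y z v) = push_right (y \<otimes> x) z v"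
  using has_tangent_tangent_map[OF has_tangent_compose[OF cover cover has_tangent_right_mult[of y z] has_tangent_right_mult[of x]]]
  by (simp add: m_assoc)

lemma push_left_push_right: "push_left x (z \<otimes> y) (push_right y z v) = push_right y (x \<otimes> z) (push_left x z v)"
  using has_tangent_tangent_map[OF has_tangent_compose[OF cover cover has_tangent_right_mult[of y z] has_tangent_left_mult[of x]]]
    has_tangent_tangent_map[OF has_tangent_compose[OF cover cover has_tangent_left_mult[of x z] has_tangent_right_mult[of y]]]
  by (simp add: m_assoc fun_eq_iff)

lemma tangent_map_ident [simp]: "tangent_map A A (\<lambda>h. h) x v = v"
  using has_tangent_tangent_map[OF has_tangent_ident[OF cover]] by metis

lemma linear_push: "linear (push_left x y)" "linear (push_right x y)"
  using has_tangent_linear has_tangent_left_mult has_tangent_right_mult by blast+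

lemma Ad_eq: "Ad G A h v = push_right (inv h) h (push_left h \<one> v)"
  using has_tangent_tangent_map[OF has_tangent_compose[OF cover cover has_tangent_left_mult[of h \<one>] has_tangent_right_mult[of "inv h"]]]
  by (simp add: Ad_def)

lemma linear_Ad: "linear (Ad G A h)"
  using linear_compose[OF linear_push(1)[of h \<one>] linear_push(2)[of "inv h" h]]
  by (simp add: Ad_eq[abs_def] o_def)

lemma left_translate_inv: "left_translate G A x (push_left (inv x) x v) = v"
  using push_left_push_left[of x "inv x" x v] by (simp add: left_translate_def)

section \<open>Variation of the discrete velocities\<close>

text \<open>
  The formula \<open>\<delta>h = h \<zeta>\<^sub>2 - \<zeta>\<^sub>1 h\<close> for \<open>h = c\<^sub>1\<^sup>-\<^sup>1 c\<^sub>2\<close> and \<open>\<delta>c\<^sub>i = c\<^sub>i \<zeta>\<^sub>i\<close>. Smoothness of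
  inversion makes \<open>h\<close> differentiable; the derivative of \<open>h\<close> is then found from the product rule for
  \<open>c\<^sub>1 h = c\<^sub>2\<close>, which avoids a formula for the tangent map of the inversion.
\<close>

lemma has_tangent_relative_position:
  assumes "chart_cover C"
    and "has_tangent C A c\<^sub>1 p (\<lambda>v. left_translate G A (c\<^sub>1 p) (Z\<^sub>1 v))"
    and "has_tangent C A c\<^sub>2 p (\<lambda>v. left_translate G A (c\<^sub>2 p) (Z\<^sub>2 v))"
  defines "h \<equiv> inv (c\<^sub>1 p) \<otimes> c\<^sub>2 p"
  shows "has_tangent C A (\<lambda>q. inv (c\<^sub>1 q) \<otimes> c\<^sub>2 q) p
    (\<lambda>v. left_translate G A h (Z\<^sub>2 v) - push_right h \<one> (Z\<^sub>1 v))"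
proof -
  let ?x = "c\<^sub>1 p"
  have xh: "?x \<otimes> h = c\<^sub>2 p" by (simp add: h_def m_assoc[symmetric])
  have "has_tangent A A (\<lambda>x. inv x) ?x (tangent_map A A (\<lambda>x. inv x) ?x)"
    by (rule manifold_smooth_on_has_tangent[OF cover cover smooth_inverse]) auto
  from has_tangent_mult[OF assms(1) has_tangent_compose[OF assms(1) cover assms(2) this] assms(3)]
  obtain E where E: "has_tangent C A (\<lambda>q. inv (c\<^sub>1 q) \<otimes> c\<^sub>2 q) p E" by blast
  have "c\<^sub>1 q \<otimes> (inv (c\<^sub>1 q) \<otimes> c\<^sub>2 q) = c\<^sub>2 q" for q
    by (simp add: m_assoc[symmetric])
  then have "has_tangent C A c\<^sub>2 p
      (\<lambda>v. push_right h ?x (left_translate G A ?x (Z\<^sub>1 v)) + push_left ?x h (E v))"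
    using has_tangent_mult[OF assms(1) assms(2) E] by (simp add: h_def)
  from has_tangent_unique[OF this assms(3)]
  have eq: "left_translate G A (c\<^sub>2 p) (Z\<^sub>2 v) =
      push_right h ?x (left_translate G A ?x (Z\<^sub>1 v)) + push_left ?x h (E v)" for v
    by (metis (no_types, lifting))
  have cancel: "push_left (inv ?x) (c\<^sub>2 p) (push_left ?x h w) = w" for w
    using push_left_push_left[of "inv ?x" ?x h w] by (simp add: xh)
  have "E v = left_translate G A h (Z\<^sub>2 v) - push_right h \<one> (Z\<^sub>1 v)" for v
  proof -
    have "push_left ?x h (left_translate G A h (Z\<^sub>2 v)) = left_translate G A (c\<^sub>2 p) (Z\<^sub>2 v)"
      using push_left_push_left[of ?x h \<one>] by (simp add: left_translate_def xh)
    moreover have "push_left ?x h (push_right h \<one> (Z\<^sub>1 v)) = push_right h ?x (left_translate G A ?x (Z\<^sub>1 v))"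
      using push_left_push_right[of ?x \<one> h] by (simp add: left_translate_def)
    ultimately have "push_left ?x h (left_translate G A h (Z\<^sub>2 v) - push_right h \<one> (Z\<^sub>1 v)) = push_left ?x h (E v)"
      using eq[of v] by (simp add: linear_diff[OF linear_push(1)])
    then show ?thesis using cancel by metis
  qed
  then show ?thesis using E by (metis (no_types, lifting) ext)
qed

lemma inv_into_tau_has_tangent:
  assumes "diffeomorphism_on vec_atlas A W \<tau>" and "w \<in> W"
  shows "has_tangent A vec_atlas (inv_into W \<tau>) (\<tau> w) (tangent_map A vec_atlas (inv_into W \<tau>) (\<tau> w))"
  using assms by (intro manifold_smooth_on_has_tangent[OF cover chart_cover_vec_atlas, of "\<tau> ` W"])
    (auto simp: diffeomorphism_on_def)

text \<open>
  The right trivialized derivative of \<open>\<tau>\<close> is the composition of two invertible maps, the tangent map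
  of \<open>\<tau>\<close> at \<open>w\<close> and a right translation, so its inverse is the composition of the tangent map of
  the local inverse of \<open>\<tau>\<close> with the opposite translation. In particular it is linear.
\<close>

lemma dtau_inv_eq:
  assumes "diffeomorphism_on vec_atlas A W \<tau>" and "w \<in> W"
  shows "dtau_inv G A \<tau> w = (\<lambda>v. tangent_map A vec_atlas (inv_into W \<tau>) (\<tau> w) (push_right (\<tau> w) \<one> v))"
proof -
  let ?T = "tangent_map vec_atlas A \<tau> w" and ?S = "tangent_map A vec_atlas (inv_into W \<tau>) (\<tau> w)"
  have W: "open W" "open (\<tau> ` W)" "inj_on \<tau> W" "manifold_smooth_on vec_atlas A W \<tau>"
    using assms(1) by (auto simp: diffeomorphism_on_def)
  have T: "has_tangent vec_atlas A \<tau> w ?T"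
    by (rule manifold_smooth_on_has_tangent[OF chart_cover_vec_atlas cover W(4,1) assms(2)])
  note S = inv_into_tau_has_tangent[OF assms]
  have w: "inv_into W \<tau> (\<tau> w) = w" using W(3) assms(2) by simp
  have ST: "?S (?T v) = v" for v
  proof -
    have "has_tangent vec_atlas vec_atlas (\<lambda>q. q) w (\<lambda>v. ?S (?T v))"
    proof (rule has_tangent_cong[OF chart_cover_vec_atlas has_tangent_compose[OF chart_cover_vec_atlas cover T S]])
      show "eventually (\<lambda>q. inv_into W \<tau> (\<tau> q) = q) (nhds w)"
        using eventually_nhds_in_open[OF W(1) assms(2)] by eventually_elim (simp add: W(3))
    qed
    from has_tangent_unique[OF this has_tangent_ident[OF chart_cover_vec_atlas]]
    show ?thesis by (rule fun_cong)
  qed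
  have TS: "?T (?S v) = v" for v
  proof -
    have "has_tangent A A (\<lambda>q. q) (\<tau> w) (\<lambda>v. ?T (?S v))"
    proof (rule has_tangent_cong[OF cover has_tangent_compose[OF cover chart_cover_vec_atlas S]])
      show "has_tangent vec_atlas A \<tau> (inv_into W \<tau> (\<tau> w)) ?T" using T by (simp add: w)
      have "eventually (\<lambda>q. q \<in> \<tau> ` W) (nhds (\<tau> w))"
        using W(2) assms(2) by (intro eventually_nhds_in_open) auto
      then show "eventually (\<lambda>q. \<tau> (inv_into W \<tau> q) = q) (nhds (\<tau> w))"
        by eventually_elim (simp add: f_inv_into_f)
    qed
    from has_tangent_unique[OF this has_tangent_ident[OF cover]]
    show ?thesis by (rule fun_cong)
  qed
  have "push_right (\<tau> w) \<one> (push_right (inv (\<tau> w)) (\<tau> w) v) = v"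
    and "push_right (inv (\<tau> w)) (\<tau> w) (push_right (\<tau> w) \<one> v) = v" for v
    using push_right_push_right[of "\<tau> w" "\<tau> w" "inv (\<tau> w)" v]
      push_right_push_right[of "inv (\<tau> w)" \<one> "\<tau> w" v] by auto
  then show ?thesis
    unfolding dtau_inv_def using ST TS
    by (intro inv_unique_comp) (auto simp: dtau_def fun_eq_iff)
qed

lemma linear_dtau_inv:
  assumes "diffeomorphism_on vec_atlas A W \<tau>" and "w \<in> W"
  shows "linear (dtau_inv G A \<tau> w)"
  using linear_compose[OF linear_push(2) has_tangent_linear[OF inv_into_tau_has_tangent[OF assms]]]
  by (simp add: dtau_inv_eq[OF assms] o_def)

lemma linear_discrete_momentum:
  assumes "diffeomorphism_on vec_atlas A W \<tau>" and "\<Delta> *\<^sub>R \<xi> \<in> W" and "F differentiable (at \<xi>)"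
  shows "linear (discrete_momentum G A \<tau> \<Delta> F \<xi>)"
  unfolding discrete_momentum_def
  using linear_dtau_inv[OF assms(1,2)] linear_frechet_derivative[OF assms(3)] by (rule linear_compose)

text \<open>
  Here \<open>F\<close> is the kinetic or bending energy density, \<open>\<Delta>\<close> the corresponding step and \<open>c\<^sub>1, c\<^sub>2\<close> are the
  variations of two neighbouring group elements. By \<open>has_tangent_relative_position\<close> and
  \<open>dtau_inv_eq\<close> the velocity satisfies \<open>\<Delta> \<delta>\<xi> = d\<tau>\<^sup>-\<^sup>1 (Ad\<^sub>h \<zeta>\<^sub>2 - \<zeta>\<^sub>1)\<close>.
\<close>

lemma energy_variation:
  fixes c\<^sub>1 c\<^sub>2 :: "real \<Rightarrow> 'g" and F :: "'e \<Rightarrow> real"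
  assumes \<tau>: "diffeomorphism_on vec_atlas A W \<tau>" and "\<Delta> \<noteq> 0"
    and c\<^sub>1: "has_tangent vec_atlas A c\<^sub>1 0 (\<lambda>s. s *\<^sub>R left_translate G A (c\<^sub>1 0) \<zeta>\<^sub>1)"
    and c\<^sub>2: "has_tangent vec_atlas A c\<^sub>2 0 (\<lambda>s. s *\<^sub>R left_translate G A (c\<^sub>2 0) \<zeta>\<^sub>2)"
    and in_W: "inv (c\<^sub>1 0) \<otimes> c\<^sub>2 0 \<in> \<tau> ` W"
  defines "\<xi> \<equiv> discrete_velocity G \<tau> W \<Delta> (c\<^sub>1 0) (c\<^sub>2 0)"
  defines "\<mu> \<equiv> discrete_momentum G A \<tau> \<Delta> F \<xi>"
  assumes F: "F differentiable (at \<xi>)"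
  shows "((\<lambda>t. F (discrete_velocity G \<tau> W \<Delta> (c\<^sub>1 t) (c\<^sub>2 t))) has_real_derivative
    1 / \<Delta> * (Ad_star G A (\<tau> (\<Delta> *\<^sub>R \<xi>)) \<mu> \<zeta>\<^sub>2 - \<mu> \<zeta>\<^sub>1)) (at 0)"
proof -
  define h where "h = inv (c\<^sub>1 0) \<otimes> c\<^sub>2 0"
  define w where "w = inv_into W \<tau> h"
  have w: "w \<in> W" "\<tau> w = h"
    using in_W by (auto simp: w_def h_def inv_into_into f_inv_into_f)
  have \<xi>: "\<Delta> *\<^sub>R \<xi> = w" using assms(2) by (simp add: \<xi>_def discrete_velocity_def w_def h_def)
  let ?S = "tangent_map A vec_atlas (inv_into W \<tau>) h"
  note lin = linear_dtau_inv[OF \<tau> w(1)]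
  have scale: "s *\<^sub>R left_translate G A x z = left_translate G A x (s *\<^sub>R z)" for s x z
    by (simp add: left_translate_def linear_scale[OF linear_push(1)])
  have "has_tangent vec_atlas A (\<lambda>t. inv (c\<^sub>1 t) \<otimes> c\<^sub>2 t) 0
      (\<lambda>s. left_translate G A h (s *\<^sub>R \<zeta>\<^sub>2) - push_right h \<one> (s *\<^sub>R \<zeta>\<^sub>1))"
    unfolding h_def using c\<^sub>1 c\<^sub>2
    by (intro has_tangent_relative_position[OF chart_cover_vec_atlas]) (simp_all add: scale)
  from has_tangent_compose[OF chart_cover_vec_atlas cover this]
  have "((\<lambda>t. inv_into W \<tau> (inv (c\<^sub>1 t) \<otimes> c\<^sub>2 t)) has_derivative
      (\<lambda>s. ?S (left_translate G A h (s *\<^sub>R \<zeta>\<^sub>2) - push_right h \<one> (s *\<^sub>R \<zeta>\<^sub>1)))) (at 0)"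
    using inv_into_tau_has_tangent[OF \<tau> w(1)] unfolding w(2) has_tangent_vec_atlas[symmetric]
    by (simp add: h_def)
  moreover have "?S (left_translate G A h (s *\<^sub>R \<zeta>\<^sub>2) - push_right h \<one> (s *\<^sub>R \<zeta>\<^sub>1)) =
      s *\<^sub>R dtau_inv G A \<tau> w (Ad G A h \<zeta>\<^sub>2 - \<zeta>\<^sub>1)" for s
  proof -
    have "push_right h \<one> (Ad G A h \<zeta>\<^sub>2) = left_translate G A h \<zeta>\<^sub>2"
      using push_right_push_right[of h h "inv h"] by (simp add: Ad_eq left_translate_def)
    then have "left_translate G A h (s *\<^sub>R \<zeta>\<^sub>2) - push_right h \<one> (s *\<^sub>R \<zeta>\<^sub>1) =
        push_right h \<one> (s *\<^sub>R (Ad G A h \<zeta>\<^sub>2 - \<zeta>\<^sub>1))"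
      by (simp add: linear_diff[OF linear_push(2)] linear_scale[OF linear_push(2)] scaleR_diff_right flip: scale)
    then have "?S (left_translate G A h (s *\<^sub>R \<zeta>\<^sub>2) - push_right h \<one> (s *\<^sub>R \<zeta>\<^sub>1)) =
        dtau_inv G A \<tau> w (s *\<^sub>R (Ad G A h \<zeta>\<^sub>2 - \<zeta>\<^sub>1))"
      by (simp add: dtau_inv_eq[OF \<tau> w(1)] w(2))
    then show ?thesis by (simp add: linear_scale[OF lin])
  qed
  ultimately have "((\<lambda>t. inv_into W \<tau> (inv (c\<^sub>1 t) \<otimes> c\<^sub>2 t)) has_derivative
      (\<lambda>s. s *\<^sub>R dtau_inv G A \<tau> w (Ad G A h \<zeta>\<^sub>2 - \<zeta>\<^sub>1))) (at 0)" by simp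
  from has_derivative_scaleR_right[OF this, of "1 / \<Delta>"]
  have "((\<lambda>t. discrete_velocity G \<tau> W \<Delta> (c\<^sub>1 t) (c\<^sub>2 t)) has_derivative
      (\<lambda>s. (1 / \<Delta>) *\<^sub>R s *\<^sub>R dtau_inv G A \<tau> w (Ad G A h \<zeta>\<^sub>2 - \<zeta>\<^sub>1))) (at 0)"
    by (simp add: discrete_velocity_def)
  moreover have DF: "(F has_derivative frechet_derivative F (at \<xi>)) (at \<xi>)"
    using F by (simp add: frechet_derivative_works)
  ultimately have "((\<lambda>t. F (discrete_velocity G \<tau> W \<Delta> (c\<^sub>1 t) (c\<^sub>2 t))) has_derivative
      (\<lambda>s. frechet_derivative F (at \<xi>) ((1 / \<Delta>) *\<^sub>R s *\<^sub>R dtau_inv G A \<tau> w (Ad G A h \<zeta>\<^sub>2 - \<zeta>\<^sub>1)))) (at 0)"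
    unfolding \<xi>_def by (rule has_derivative_compose)
  moreover have "frechet_derivative F (at \<xi>) ((1 / \<Delta>) *\<^sub>R s *\<^sub>R dtau_inv G A \<tau> w (Ad G A h \<zeta>\<^sub>2 - \<zeta>\<^sub>1)) =
      1 / \<Delta> * (Ad_star G A (\<tau> (\<Delta> *\<^sub>R \<xi>)) \<mu> \<zeta>\<^sub>2 - \<mu> \<zeta>\<^sub>1) * s" for s
    using has_derivative_linear[OF DF]
    by (simp add: \<mu>_def discrete_momentum_def Ad_star_def \<xi> w(2) linear_diff[OF lin] linear_diff linear_scale
          algebra_simps diff_divide_distrib)
  ultimately show ?thesis
    by (simp only: has_field_derivative_def)
qed

lemma linear_left_trivialize_differential:
  assumes "manifold_smooth_on A vec_atlas UNIV P"
  shows "linear (left_trivialize G A x (differential A P x))"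
proof -
  have "has_tangent A vec_atlas P x (tangent_map A vec_atlas P x)"
    by (rule manifold_smooth_on_has_tangent[OF cover chart_cover_vec_atlas assms]) auto
  then show ?thesis
    using linear_compose[OF linear_push(1) has_tangent_linear]
    by (auto simp: left_trivialize_def differential_def left_translate_def)
qed

lemma potential_variation:
  fixes c :: "real \<Rightarrow> 'g"
  assumes "manifold_smooth_on A vec_atlas UNIV P"
    and c: "has_tangent vec_atlas A c 0 (\<lambda>s. s *\<^sub>R left_translate G A (c 0) \<zeta>)"
  shows "((\<lambda>t. P (c t)) has_real_derivative left_trivialize G A (c 0) (differential A P (c 0)) \<zeta>) (at 0)"
proof -
  have P: "has_tangent A vec_atlas P (c 0) (tangent_map A vec_atlas P (c 0))"
    by (rule manifold_smooth_on_has_tangent[OF cover chart_cover_vec_atlas assms(1)]) auto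
  show ?thesis
    using has_tangent_compose[OF chart_cover_vec_atlas cover c P]
    by (simp add: has_tangent_vec_atlas linear_scale[OF has_tangent_linear[OF P]] left_trivialize_def
        differential_def has_field_derivative_def mult_commute_abs)
qed

end

section \<open>Summation by parts\<close>

lemma sum_drop_first:
  fixes f :: "nat \<Rightarrow> 'a::comm_monoid_add"
  shows "f 0 = 0 \<Longrightarrow> (\<Sum>j = 0..n. f j) = (\<Sum>j = 1..n. f j)"
  by (simp add: sum.atLeast_Suc_atMost)

lemma sum_shift_last:
  fixes f :: "nat \<Rightarrow> 'a::comm_monoid_add"
  assumes "f n = 0"
  shows "(\<Sum>j = 0..n. f j) = (\<Sum>j = 1..n. f (j - 1))"
proof -
  have "(\<Sum>j = 0..n. f j) = (\<Sum>j = 0..<n. f j)"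
    using assms by (simp add: atLeastLessThanSuc_atLeastAtMost[symmetric])
  also have "\<dots> = (\<Sum>j = 1..n. f (j - 1))"
    by (rule sum.reindex_bij_witness[of _ "\<lambda>j. j - 1" Suc]) auto
  finally show ?thesis .
qed

text \<open>
  The two index shifts produce no boundary terms: \<open>m'\<close>, which is shifted in \<open>j\<close>, vanishes for the last
  \<open>j\<close>, and \<open>l'\<close>, which is shifted in \<open>a\<close>, vanishes for the last \<open>a\<close>.
\<close>

lemma summation_by_parts:
  fixes m m' l l' p :: "nat \<Rightarrow> nat \<Rightarrow> real"
  assumes zero: "\<And>j a. j \<le> n \<Longrightarrow> a \<le> k \<Longrightarrow> j = 0 \<or> a = 0 \<Longrightarrow> m j a = 0 \<and> l j a = 0 \<and> p j a = 0"
    and m': "\<And>j a. j \<le> n \<Longrightarrow> a \<le> k \<Longrightarrow> j = n \<or> a = 0 \<Longrightarrow> m' j a = 0"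
    and l': "\<And>j a. j \<le> n \<Longrightarrow> a \<le> k \<Longrightarrow> j = 0 \<or> a = k \<Longrightarrow> l' j a = 0"
  shows "(\<Sum>j = 0..n. \<Sum>a = 0..k. x * (m' j a - m j a) - y * (l' j a - l j a) - p j a) =
    (\<Sum>j = 1..n. \<Sum>a = 1..k. x * (- m j a + m' (j - 1) a) + y * (l j a - l' j (a - 1)) - p j a)"
proof -
  have drop: "(\<Sum>j = 0..n. \<Sum>a = 0..k. f j a) = (\<Sum>j = 1..n. \<Sum>a = 1..k. f j a)"
    if "\<And>j a. j \<le> n \<Longrightarrow> a \<le> k \<Longrightarrow> j = 0 \<or> a = 0 \<Longrightarrow> f j a = 0" for f :: "nat \<Rightarrow> nat \<Rightarrow> real"
  proof -
    have "(\<Sum>j = 0..n. \<Sum>a = 0..k. f j a) = (\<Sum>j = 0..n. \<Sum>a = 1..k. f j a)"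
      by (intro sum.cong refl sum_drop_first that) simp_all
    also have "\<dots> = (\<Sum>j = 1..n. \<Sum>a = 1..k. f j a)"
      by (intro sum_drop_first sum.neutral ballI that) simp_all
    finally show ?thesis .
  qed
  have m_sum: "(\<Sum>j = 0..n. \<Sum>a = 0..k. m j a) = (\<Sum>j = 1..n. \<Sum>a = 1..k. m j a)"
    and l_sum: "(\<Sum>j = 0..n. \<Sum>a = 0..k. l j a) = (\<Sum>j = 1..n. \<Sum>a = 1..k. l j a)"
    and p_sum: "(\<Sum>j = 0..n. \<Sum>a = 0..k. p j a) = (\<Sum>j = 1..n. \<Sum>a = 1..k. p j a)"
    using zero by (intro drop; blast)+
  have m'_sum: "(\<Sum>j = 0..n. \<Sum>a = 0..k. m' j a) = (\<Sum>j = 1..n. \<Sum>a = 1..k. m' (j - 1) a)"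
  proof -
    have "(\<Sum>j = 0..n. \<Sum>a = 0..k. m' j a) = (\<Sum>j = 0..n. \<Sum>a = 1..k. m' j a)"
      by (intro sum.cong refl sum_drop_first m') simp_all
    also have "\<dots> = (\<Sum>j = 1..n. \<Sum>a = 1..k. m' (j - 1) a)"
      by (intro sum_shift_last sum.neutral ballI m') simp_all
    finally show ?thesis .
  qed
  have l'_sum: "(\<Sum>j = 0..n. \<Sum>a = 0..k. l' j a) = (\<Sum>j = 1..n. \<Sum>a = 1..k. l' j (a - 1))"
  proof -
    have "(\<Sum>j = 0..n. \<Sum>a = 0..k. l' j a) = (\<Sum>j = 0..n. \<Sum>a = 1..k. l' j (a - 1))"
      by (intro sum.cong refl sum_shift_last l') simp_all
    also have "\<dots> = (\<Sum>j = 1..n. \<Sum>a = 1..k. l' j (a - 1))"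
      by (intro sum_drop_first sum.neutral ballI l') (simp_all, linarith)
    finally show ?thesis .
  qed
  have "(\<Sum>j = 0..n. \<Sum>a = 0..k. x * (m' j a - m j a) - y * (l' j a - l j a) - p j a) =
      x * (\<Sum>j = 0..n. \<Sum>a = 0..k. m' j a) - x * (\<Sum>j = 0..n. \<Sum>a = 0..k. m j a)
      - y * (\<Sum>j = 0..n. \<Sum>a = 0..k. l' j a) + y * (\<Sum>j = 0..n. \<Sum>a = 0..k. l j a)
      - (\<Sum>j = 0..n. \<Sum>a = 0..k. p j a)"
    by (simp add: sum_subtractf sum_distrib_left right_diff_distrib)
  also have "\<dots> = (\<Sum>j = 1..n. \<Sum>a = 1..k. x * (- m j a + m' (j - 1) a) + y * (l j a - l' j (a - 1)) - p j a)"
    unfolding m'_sum l'_sum m_sum l_sum p_sum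
    by (simp add: sum_subtractf sum.distrib sum_negf sum_distrib_left right_diff_distrib distrib_left)
  finally show ?thesis .
qed

theorem proposition3p2:
  fixes G :: "('g::{t2_space, second_countable_topology}) monoid"
    and \<A> :: "('g, 'e::real_normed_vector) atlas"
    and \<tau> :: "'e \<Rightarrow> 'g" and W :: "'e set"
    and K \<Phi> :: "'e \<Rightarrow> real" and Pot :: "'g \<Rightarrow> real"
    and dt ds :: real and N A :: nat
    and g :: "nat \<Rightarrow> nat \<Rightarrow> 'g"
    and \<xi> \<eta> :: "nat \<Rightarrow> nat \<Rightarrow> 'e" and \<mu> lam :: "nat \<Rightarrow> nat \<Rightarrow> 'e covector"
  assumes "lie_group G \<A>"
    and "smooth_on UNIV K" and "smooth_on UNIV \<Phi>"
    and "manifold_smooth_on \<A> vec_atlas UNIV Pot"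
    and "manifold_smooth_on vec_atlas \<A> UNIV \<tau>" and "\<tau> 0 = \<one>\<^bsub>G\<^esub>"
    and "0 \<in> W" and "diffeomorphism_on vec_atlas \<A> W \<tau>"
    and "dt > 0" and "ds > 0" and "N \<ge> 1" and "A \<ge> 1"
    and "\<forall>j\<in>{0..N - 1}. \<forall>a\<in>{0..A - 1}. inv\<^bsub>G\<^esub> (g j a) \<otimes>\<^bsub>G\<^esub> g (j + 1) a \<in> \<tau> ` W"
    and "\<forall>j\<in>{0..N - 1}. \<forall>a\<in>{0..A - 1}. inv\<^bsub>G\<^esub> (g j a) \<otimes>\<^bsub>G\<^esub> g j (a + 1) \<in> \<tau> ` W"
    and "\<forall>j a. \<xi> j a = convective_velocity G \<tau> W dt g j a"
    and "\<forall>j a. \<eta> j a = convective_strain G \<tau> W ds g j a"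
    and "\<forall>j a. \<mu> j a = discrete_momentum G \<A> \<tau> dt K (\<xi> j a)"
    and "\<forall>j a. lam j a = discrete_momentum G \<A> \<tau> ds \<Phi> (\<eta> j a)"
  shows
    "(\<forall>(\<delta>g :: nat \<Rightarrow> nat \<Rightarrow> 'e) (\<gamma> :: nat \<Rightarrow> nat \<Rightarrow> real \<Rightarrow> 'g).
        (\<forall>j\<in>{0..N}. \<forall>a\<in>{0..A}. smooth_curve_through \<A> (\<gamma> j a) (g j a) (\<delta>g j a)) \<longrightarrow>
        (\<forall>j\<in>{0..N}. \<forall>a\<in>{0..A}. j \<in> {0, N} \<or> a \<in> {0, A} \<longrightarrow> \<delta>g j a = 0) \<longrightarrow>
        ((\<lambda>\<epsilon>. discrete_action G \<tau> W dt ds (discrete_lagrangian dt ds K \<Phi> Pot) N A (\<lambda>j a. \<gamma> j a \<epsilon>))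
           has_real_derivative 0) (at 0))
     \<longleftrightarrow>
     (\<forall>j\<in>{1..N - 1}. \<forall>a\<in>{1..A - 1}. \<forall>\<zeta>.
        1 / dt * (- \<mu> j a \<zeta> + Ad_star G \<A> (\<tau> (dt *\<^sub>R \<xi> (j - 1) a)) (\<mu> (j - 1) a) \<zeta>) +
        1 / ds * (lam j a \<zeta> - Ad_star G \<A> (\<tau> (ds *\<^sub>R \<eta> j (a - 1))) (lam j (a - 1)) \<zeta>) -
        left_trivialize G \<A> (g j a) (differential \<A> Pot (g j a)) \<zeta> = 0)"
    (is "?hamilton \<longleftrightarrow> (\<forall>j\<in>{1..N - 1}. \<forall>a\<in>{1..A - 1}. \<forall>\<zeta>. ?EL j a \<zeta> = 0)")
proof -
  interpret lie_group G \<A> by fact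
  have smooth: "F differentiable (at x)" if "smooth_on UNIV F" for F :: "'e \<Rightarrow> real" and x
    using smooth_on_differentiable[OF that] by simp
  \<comment> \<open>The momenta are known to be linear only where the relative positions lie in the image of \<open>W\<close>,
    hence the restriction to indices of triangles.\<close>
  have \<mu>_zero: "\<mu> j a 0 = 0" and lam_zero: "lam j a 0 = 0"
    if "j \<in> {0..N - 1}" and "a \<in> {0..A - 1}" for j a
  proof -
    have "dt *\<^sub>R \<xi> j a \<in> W" "ds *\<^sub>R \<eta> j a \<in> W"
      using assms(9,10,13-16) that
      by (simp_all add: convective_velocity_def convective_strain_def discrete_velocity_def inv_into_into)
    then show "\<mu> j a 0 = 0" "lam j a 0 = 0"
      using linear_discrete_momentum[OF assms(8)] smooth assms(2,3,17,18) by (auto intro: linear_0)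
  qed
  have Ad_star_zero: "Ad_star G \<A> x \<alpha> 0 = 0" if "\<alpha> 0 = 0" for x and \<alpha> :: "'e covector"
    using that by (simp add: Ad_star_def linear_0[OF linear_Ad])
  have Pot_zero: "left_trivialize G \<A> x (differential \<A> Pot x) 0 = 0" for x
    by (rule linear_0[OF linear_left_trivialize_differential[OF assms(4)]])
  \<comment> \<open>The first variation on one triangle, divided by the factor \<open>dt * ds\<close>.\<close>
  let ?dS = "\<lambda>\<zeta> j a. 1 / dt * (Ad_star G \<A> (\<tau> (dt *\<^sub>R \<xi> j a)) (\<mu> j a) (\<zeta> (j + 1) a) - \<mu> j a (\<zeta> j a)) -
      1 / ds * (Ad_star G \<A> (\<tau> (ds *\<^sub>R \<eta> j a)) (lam j a) (\<zeta> j (a + 1)) - lam j a (\<zeta> j a)) -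
      left_trivialize G \<A> (g j a) (differential \<A> Pot (g j a)) (\<zeta> j a)"
  let ?S = "discrete_action G \<tau> W dt ds (discrete_lagrangian dt ds K \<Phi> Pot) N A"
  have variation: "((\<lambda>\<epsilon>. ?S (\<lambda>j a. \<gamma> j a \<epsilon>)) has_real_derivative
      dt * ds * (\<Sum>j = 1..N - 1. \<Sum>a = 1..A - 1. ?EL j a (\<zeta> j a))) (at 0)"
    if \<gamma>: "\<And>j a. j \<in> {0..N} \<Longrightarrow> a \<in> {0..A} \<Longrightarrow>
        smooth_curve_through \<A> (\<gamma> j a) (g j a) (left_translate G \<A> (g j a) (\<zeta> j a))"
      and \<zeta>: "\<And>j a. j \<in> {0..N} \<Longrightarrow> a \<in> {0..A} \<Longrightarrow> j \<in> {0, N} \<or> a \<in> {0, A} \<Longrightarrow> \<zeta> j a = 0" for \<gamma> \<zeta>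
  proof -
    have c: "\<gamma> j a 0 = g j a"
      "has_tangent vec_atlas \<A> (\<gamma> j a) 0 (\<lambda>s. s *\<^sub>R left_translate G \<A> (\<gamma> j a 0) (\<zeta> j a))"
      if "j \<in> {0..N}" and "a \<in> {0..A}" for j a
      using smooth_curve_through_has_tangent[OF cover \<gamma>[OF that]] by simp_all
    have "((\<lambda>\<epsilon>. discrete_lagrangian dt ds K \<Phi> Pot (triangle j a) (\<gamma> j a \<epsilon>)
          (discrete_velocity G \<tau> W dt (\<gamma> j a \<epsilon>) (\<gamma> (j + 1) a \<epsilon>))
          (discrete_velocity G \<tau> W ds (\<gamma> j a \<epsilon>) (\<gamma> j (a + 1) \<epsilon>)))
        has_real_derivative dt * ds * ?dS \<zeta> j a) (at 0)"
      if j: "j \<in> {0..N - 1}" and a: "a \<in> {0..A - 1}" for j a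
    proof -
      have ja: "j \<in> {0..N}" "j + 1 \<in> {0..N}" "a \<in> {0..A}" "a + 1 \<in> {0..A}"
        using j a \<open>N \<ge> 1\<close> \<open>A \<ge> 1\<close> by auto
      have \<xi>: "discrete_velocity G \<tau> W dt (\<gamma> j a 0) (\<gamma> (j + 1) a 0) = \<xi> j a"
        and \<eta>: "discrete_velocity G \<tau> W ds (\<gamma> j a 0) (\<gamma> j (a + 1) 0) = \<eta> j a"
        using assms(15,16) c(1) ja by (simp_all add: convective_velocity_def convective_strain_def)
      have "((\<lambda>\<epsilon>. K (discrete_velocity G \<tau> W dt (\<gamma> j a \<epsilon>) (\<gamma> (j + 1) a \<epsilon>))) has_real_derivative
          1 / dt * (Ad_star G \<A> (\<tau> (dt *\<^sub>R \<xi> j a)) (\<mu> j a) (\<zeta> (j + 1) a) - \<mu> j a (\<zeta> j a))) (at 0)"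
        using energy_variation[OF assms(8) _ c(2)[OF ja(1,3)] c(2)[OF ja(2,3)] _ smooth[OF assms(2)], of dt]
          assms(9,13,17) j a c(1) ja unfolding \<xi> by simp
      moreover have "((\<lambda>\<epsilon>. \<Phi> (discrete_velocity G \<tau> W ds (\<gamma> j a \<epsilon>) (\<gamma> j (a + 1) \<epsilon>))) has_real_derivative
          1 / ds * (Ad_star G \<A> (\<tau> (ds *\<^sub>R \<eta> j a)) (lam j a) (\<zeta> j (a + 1)) - lam j a (\<zeta> j a))) (at 0)"
        using energy_variation[OF assms(8) _ c(2)[OF ja(1,3)] c(2)[OF ja(1,4)] _ smooth[OF assms(3)], of ds]
          assms(10,14,18) j a c(1) ja unfolding \<eta> by simp
      moreover have "((\<lambda>\<epsilon>. Pot (\<gamma> j a \<epsilon>)) has_real_derivative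
          left_trivialize G \<A> (g j a) (differential \<A> Pot (g j a)) (\<zeta> j a)) (at 0)"
        using potential_variation[OF assms(4) c(2)[OF ja(1,3)]] c(1)[OF ja(1,3)] by simp
      ultimately show ?thesis
        unfolding discrete_lagrangian_def by (intro DERIV_cmult DERIV_diff)
    qed
    then have "((\<lambda>\<epsilon>. ?S (\<lambda>j a. \<gamma> j a \<epsilon>)) has_real_derivative
        (\<Sum>j = 0..N - 1. \<Sum>a = 0..A - 1. dt * ds * ?dS \<zeta> j a)) (at 0)"
      unfolding discrete_action_def convective_velocity_def convective_strain_def
      by (intro DERIV_sum)
    moreover have "(\<Sum>j = 0..N - 1. \<Sum>a = 0..A - 1. dt * ds * ?dS \<zeta> j a) =
        dt * ds * (\<Sum>j = 0..N - 1. \<Sum>a = 0..A - 1. ?dS \<zeta> j a)"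
      by (simp only: sum_distrib_left)
    moreover have "(\<Sum>j = 0..N - 1. \<Sum>a = 0..A - 1. ?dS \<zeta> j a) = (\<Sum>j = 1..N - 1. \<Sum>a = 1..A - 1.
        1 / dt * (- \<mu> j a (\<zeta> j a) + Ad_star G \<A> (\<tau> (dt *\<^sub>R \<xi> (j - 1) a)) (\<mu> (j - 1) a) (\<zeta> (j - 1 + 1) a)) +
        1 / ds * (lam j a (\<zeta> j a) - Ad_star G \<A> (\<tau> (ds *\<^sub>R \<eta> j (a - 1))) (lam j (a - 1)) (\<zeta> j (a - 1 + 1))) -
        left_trivialize G \<A> (g j a) (differential \<A> Pot (g j a)) (\<zeta> j a))"
    proof (rule summation_by_parts[where m' = "\<lambda>j a. Ad_star G \<A> (\<tau> (dt *\<^sub>R \<xi> j a)) (\<mu> j a) (\<zeta> (j + 1) a)"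
          and l' = "\<lambda>j a. Ad_star G \<A> (\<tau> (ds *\<^sub>R \<eta> j a)) (lam j a) (\<zeta> j (a + 1))"], goal_cases)
      case (1 j a)
      then show ?case using \<zeta>[of j a] by (auto simp: \<mu>_zero lam_zero Pot_zero)
    next
      case (2 j a)
      then show ?case using \<zeta>[of "j + 1" a] \<open>N \<ge> 1\<close> by (auto simp: \<mu>_zero Ad_star_zero)
    next
      case (3 j a)
      then show ?case using \<zeta>[of j "a + 1"] \<open>A \<ge> 1\<close> by (auto simp: lam_zero Ad_star_zero)
    qed
    \<comment> \<open>\<open>j - 1 + 1 = j\<close> and \<open>a - 1 + 1 = a\<close> because interior indices are positive.\<close>
    moreover have "\<dots> = (\<Sum>j = 1..N - 1. \<Sum>a = 1..A - 1. ?EL j a (\<zeta> j a))"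
      by (intro sum.cong refl) simp
    ultimately show ?thesis by (simp only:)
  qed
  show ?thesis
  proof
    assume hamilton: ?hamilton
    have "?EL j a \<zeta> = 0" if j: "j \<in> {1..N - 1}" and a: "a \<in> {1..A - 1}" for j a \<zeta>
    proof -
      \<comment> \<open>A variation of the single node \<open>(j, a)\<close> picks one term from the sum.\<close>
      define \<zeta>' where "\<zeta>' = (\<lambda>i b. if i = j \<and> b = a then \<zeta> else 0)"
      define \<gamma> where "\<gamma> = (\<lambda>i b. SOME c. smooth_curve_through \<A> c (g i b) (left_translate G \<A> (g i b) (\<zeta>' i b)))"
      have \<gamma>: "smooth_curve_through \<A> (\<gamma> i b) (g i b) (left_translate G \<A> (g i b) (\<zeta>' i b))" for i b
        unfolding \<gamma>_def by (rule someI_ex[OF smooth_curve_through_exists[OF smooth_atlas]])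
      have boundary: "\<zeta>' i b = 0" if "i \<in> {0, N} \<or> b \<in> {0, A}" for i b
        using that j a by (auto simp: \<zeta>'_def)
      have "left_translate G \<A> x 0 = 0" for x
        by (simp add: left_translate_def linear_0[OF linear_push(1)])
      then have "((\<lambda>\<epsilon>. ?S (\<lambda>j a. \<gamma> j a \<epsilon>)) has_real_derivative 0) (at 0)"
        using \<gamma> boundary
        by (intro hamilton[rule_format, of \<gamma> "\<lambda>i b. left_translate G \<A> (g i b) (\<zeta>' i b)"]) simp_all
      from DERIV_unique[OF variation[of \<gamma> \<zeta>', OF \<gamma> boundary] this]
      have "(\<Sum>i = 1..N - 1. \<Sum>b = 1..A - 1. ?EL i b (\<zeta>' i b)) = 0"
        using assms(9,10) by simp
      moreover have "(\<Sum>i = 1..N - 1. \<Sum>b = 1..A - 1. ?EL i b (\<zeta>' i b)) =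
          (\<Sum>i = 1..N - 1. if i = j then \<Sum>b = 1..A - 1. if b = a then ?EL j a \<zeta> else 0 else 0)"
      proof (intro sum.cong refl)
        fix i assume i: "i \<in> {1..N - 1}"
        have "?EL i b (\<zeta>' i b) = (if i = j then if b = a then ?EL j a \<zeta> else 0 else 0)" if "b \<in> {1..A - 1}" for b
        proof -
          have "i \<in> {0..N - 1}" "i - 1 \<in> {0..N - 1}" "b \<in> {0..A - 1}" "b - 1 \<in> {0..A - 1}"
            using i that by auto
          then have zero: "?EL i b 0 = 0"
            by (simp only: \<mu>_zero lam_zero Ad_star_zero Pot_zero) simp
          show ?thesis
          proof (cases "i = j \<and> b = a")
            case True
            then show ?thesis by (simp add: \<zeta>'_def)
          next
            case False
            then have "\<zeta>' i b = 0" by (auto simp: \<zeta>'_def)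
            then show ?thesis using zero False by (simp only:) auto
          qed
        qed
        then show "(\<Sum>b = 1..A - 1. ?EL i b (\<zeta>' i b)) =
            (if i = j then \<Sum>b = 1..A - 1. if b = a then ?EL j a \<zeta> else 0 else 0)"
          by (cases "i = j") (auto intro!: sum.cong sum.neutral)
      qed
      ultimately show ?thesis using j a by simp
    qed
    then show "\<forall>j\<in>{1..N - 1}. \<forall>a\<in>{1..A - 1}. \<forall>\<zeta>. ?EL j a \<zeta> = 0" by blast
  next
    assume EL: "\<forall>j\<in>{1..N - 1}. \<forall>a\<in>{1..A - 1}. \<forall>\<zeta>. ?EL j a \<zeta> = 0"
    show ?hamilton
    proof (intro allI impI)
      fix \<delta>g :: "nat \<Rightarrow> nat \<Rightarrow> 'e" and \<gamma> :: "nat \<Rightarrow> nat \<Rightarrow> real \<Rightarrow> 'g"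
      assume \<gamma>: "\<forall>j\<in>{0..N}. \<forall>a\<in>{0..A}. smooth_curve_through \<A> (\<gamma> j a) (g j a) (\<delta>g j a)"
        and boundary: "\<forall>j\<in>{0..N}. \<forall>a\<in>{0..A}. j \<in> {0, N} \<or> a \<in> {0, A} \<longrightarrow> \<delta>g j a = 0"
      define \<zeta> where "\<zeta> = (\<lambda>j a. push_left (inv\<^bsub>G\<^esub> (g j a)) (g j a) (\<delta>g j a))"
      have "((\<lambda>\<epsilon>. ?S (\<lambda>j a. \<gamma> j a \<epsilon>)) has_real_derivative
          dt * ds * (\<Sum>j = 1..N - 1. \<Sum>a = 1..A - 1. ?EL j a (\<zeta> j a))) (at 0)"
      proof (rule variation)
        show "smooth_curve_through \<A> (\<gamma> j a) (g j a) (left_translate G \<A> (g j a) (\<zeta> j a))"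
          if "j \<in> {0..N}" and "a \<in> {0..A}" for j a
          using \<gamma> that by (simp add: \<zeta>_def left_translate_inv)
        show "\<zeta> j a = 0" if "j \<in> {0..N}" and "a \<in> {0..A}" and "j \<in> {0, N} \<or> a \<in> {0, A}" for j a
        proof -
          have "\<delta>g j a = 0" using boundary that by blast
          then show ?thesis by (simp add: \<zeta>_def linear_0[OF linear_push(1)])
        qed
      qed
      moreover have "(\<Sum>j = 1..N - 1. \<Sum>a = 1..A - 1. ?EL j a (\<zeta> j a)) = 0"
        using EL by (intro sum.neutral ballI) blast
      ultimately show "((\<lambda>\<epsilon>. ?S (\<lambda>j a. \<gamma> j a \<epsilon>)) has_real_derivative 0) (at 0)"
        by (metis (no_types, lifting) mult_zero_right)
    qed
  qed
qed

end
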